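(* Let $K$ be a field of characteristic $0$, let $m,r_1,\ldots,r_m$ be positive integers, and let $\omega_1,\ldots,\omega_m\in K$ with $\omega_i-\omega_j\notin\mathbb{Z}$ for $1\le i<j\le m$. For each $1\le i\le m$ let $1\le l_i\le r_i$, let $(s_{i,1},\ldots,s_{i,l_i})$ be positive integers with $s_{i,1}+\cdots+s_{i,l_i}=r_i$, and let $n_{i,1}>\cdots>n_{i,l_i}$ be non-negative integers. Put $$\boldsymbol{n}(i)=(\underbrace{n_{i,1},\ldots,n_{i,1}}_{s_{i,1}},\ldots,\underbrace{n_{i,l_i},\ldots,n_{i,l_i}}_{s_{i,l_i}})\in\mathbb{Z}_{\ge0}^{r_i},$$ $$\boldsymbol{r}(i)=(\underbrace{r_i-1,\ldots,r_i-1}_{n_{i,l_i}+1},\underbrace{r_i-s_{i,l_i}-1,\ldots,r_i-s_{i,l_i}-1}_{n_{i,l_i-1}-n_{i,l_i}},\ldots,\underbrace{s_{i,1}-1,\ldots,s_{i,1}-1}_{n_{i,1}-n_{i,2}})\in\mathbb{Z}_{\ge0}^{n_{i,1}+1},$$ $\boldsymbol{n}=(\boldsymbol{n}(1),\ldots,\boldsymbol{n}(m))$ and $\boldsymbol{r}=(\boldsymbol{r}(1),\ldots,\boldsymbol{r}(m))$. Let $V_{\boldsymbol{r}}\subset K[[z]]$ be the set of weight $\boldsymbol{r}$ Padé approximations of $(e^{(\omega_i+k_i)z})_{1\le i\le m,\,0\le k_i\le n_{i,1}}$ and let $W_{\boldsymbol{n}}\subset K[[z]]$ be the set of weight $\boldsymbol{n}$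 Padé approximations of $((1+z)^{\omega_i}\log^{j_i}(1+z))_{1\le i\le m,\,0\le j_i\le r_i-1}$. Then the $K$-isomorphism $\mathcal{T}:K[[z]]\to K[[z]]$, $f(z)\mapsto f(\log(1+z))$, restricts to a bijection $$\mathcal{T}:V_{\boldsymbol{r}}\longrightarrow W_{\boldsymbol{n}}.$$ In particular, the index $\boldsymbol{n}$ is normal with respect to the system $((1+z)^{\omega_i}\log^{j_i}(1+z))_{1\le i\le m,\,0\le j_i\le r_i-1}$.
   Context: For $f=\sum_k a_kz^k\in K[[z]]$, ${\rm ord}\,f=\min\{k\mid a_k\neq0\}$ (and $\infty$ if $f=0$). Let $\boldsymbol{f}=(f_1,\ldots,f_q)\in K[[z]]^q$ and $\boldsymbol{w}=(w_1,\ldots,w_q)\in\mathbb{Z}_{\ge0}^q$. A tuple $(P_1,\ldots,P_q)\in K[z]^q$ is a Padé system of approximants of $\boldsymbol{f}$ of weight $\boldsymbol{w}$ if (i) $(P_1,\ldots,P_q)\ne(0,\ldots,0)$; (ii) $\deg P_j\le w_j$ for all $j$; (iii) ${\rm ord}\big(\sum_{j=1}^qP_jf_j\big)\ge\sum_{j=1}^q(w_j+1)-1$. The power series $\sum_jP_jf_j$ is then called a Padé approximation of $\boldsymbol{f}$ of weight $\boldsymbol{w}$. The index $\boldsymbol{w}$ is normal with respect to $\boldsymbol{f}$ if every Padé approximation $R$ of $\boldsymbol{f}$ of weight $\boldsymbol{w}$ satisfies ${\rm ord}\,R=\sum_{j=1}^q(w_j+1)-1$. Families indexed by pairs $(i,k_i)$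 or $(i,j_i)$ are ordered lexicographically, matching the entries of $\boldsymbol{r}$ and $\boldsymbol{n}$. Here $\log(1+z)=\sum_{k\ge1}(-1)^{k-1}z^k/k$ and $(1+z)^{\omega}=\sum_{k\ge0}\binom{\omega}{k}z^k$ in $K[[z]]$. In $\boldsymbol{r}(i)$, reading from right to left, the block of length $n_{i,v}-n_{i,v+1}$ (for $1\le v\le l_i-1$) has all entries equal to $s_{i,1}+\cdots+s_{i,v}-1$, and the leftmost block of length $n_{i,l_i}+1$ has all entries $r_i-1$. *)

theory Defs
  imports
    Complex_Main
    "HOL-Computational_Algebra.Formal_Power_Series"
    "HOL-Computational_Algebra.Polynomial_FPS"
    "HOL-Library.Extended_Nat"
begin

text \<open>Unlike \<^const>\<open>subdegree\<close>, the order of the zero series is infinite.\<close>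

definition fps_ord :: "'a::zero fps \<Rightarrow> enat" where
  "fps_ord f = (if f = 0 then \<infinity> else enat (subdegree f))"

text \<open>
  Tuples are lists. The subtraction truncates only for the empty tuple; since
  \<^const>\<open>degree\<close> maps \<open>0\<close> to \<open>0\<close>, the degree bound
  puts no restriction on zero entries.
\<close>

definition pade_order :: "nat list \<Rightarrow> nat" where
  "pade_order w = (\<Sum>j<length w. w ! j + 1) - 1"

definition pade_sum :: "'a::comm_ring_1 fps list \<Rightarrow> 'a poly list \<Rightarrow> 'a fps" where
  "pade_sum f P = (\<Sum>j<length f. fps_of_poly (P ! j) * f ! j)"

definition pade_system :: "'a::comm_ring_1 fps list \<Rightarrow> nat list \<Rightarrow> 'a poly list \<Rightarrow> bool" where
  "pade_system f w P \<longleftrightarrow>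
     length w = length f \<and> length P = length f \<and>
     (\<exists>j<length f. P ! j \<noteq> 0) \<and>
     (\<forall>j<length f. degree (P ! j) \<le> w ! j) \<and>
     fps_ord (pade_sum f P) \<ge> enat (pade_order w)"

definition pade_approximations :: "'a::comm_ring_1 fps list \<Rightarrow> nat list \<Rightarrow> 'a fps set" where
  "pade_approximations f w = {pade_sum f P | P. pade_system f w P}"

definition normal_index :: "'a::comm_ring_1 fps list \<Rightarrow> nat list \<Rightarrow> bool" where
  "normal_index f w \<longleftrightarrow> (\<forall>R\<in>pade_approximations f w. fps_ord R = enat (pade_order w))"

text \<open>
  Below, the parameters \<open>\<omega>\<close>, \<open>r\<close>, \<open>l\<close>,
  \<open>s\<close>, \<open>n\<close> are functions whose relevant indices start at 1;
  \<open>s i v\<close> and \<open>n i v\<close> are meant for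
  \<open>1 \<le> v \<le> l i\<close>.
\<close>

definition n_block :: "(nat \<Rightarrow> nat) \<Rightarrow> (nat \<Rightarrow> nat \<Rightarrow> nat) \<Rightarrow> (nat \<Rightarrow> nat \<Rightarrow> nat) \<Rightarrow> nat \<Rightarrow> nat list" where
  "n_block l s n i = concat (map (\<lambda>v. replicate (s i v) (n i v)) [1..<l i + 1])"

definition r_block :: "(nat \<Rightarrow> nat) \<Rightarrow> (nat \<Rightarrow> nat) \<Rightarrow> (nat \<Rightarrow> nat \<Rightarrow> nat) \<Rightarrow> (nat \<Rightarrow> nat \<Rightarrow> nat) \<Rightarrow> nat \<Rightarrow> nat list" where
  "r_block r l s n i =
     replicate (n i (l i) + 1) (r i - 1) @
     concat (map (\<lambda>v. replicate (n i v - n i (v + 1)) ((\<Sum>u=1..v. s i u) - 1)) (rev [1..<l i]))"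

definition n_index :: "nat \<Rightarrow> (nat \<Rightarrow> nat) \<Rightarrow> (nat \<Rightarrow> nat \<Rightarrow> nat) \<Rightarrow> (nat \<Rightarrow> nat \<Rightarrow> nat) \<Rightarrow> nat list" where
  "n_index m l s n = concat (map (n_block l s n) [1..<m + 1])"

definition r_index :: "nat \<Rightarrow> (nat \<Rightarrow> nat) \<Rightarrow> (nat \<Rightarrow> nat) \<Rightarrow> (nat \<Rightarrow> nat \<Rightarrow> nat) \<Rightarrow> (nat \<Rightarrow> nat \<Rightarrow> nat) \<Rightarrow> nat list" where
  "r_index m r l s n = concat (map (r_block r l s n) [1..<m + 1])"

definition exp_family :: "nat \<Rightarrow> (nat \<Rightarrow> 'a::field_char_0) \<Rightarrow> (nat \<Rightarrow> nat \<Rightarrow> nat) \<Rightarrow> 'a fps list" where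
  "exp_family m \<omega> n =
     concat (map (\<lambda>i. map (\<lambda>k. fps_exp (\<omega> i + of_nat k)) [0..<n i 1 + 1]) [1..<m + 1])"

text \<open>\<open>fps_ln 1\<close> is the series of $\log(1+z)$, \<open>fps_binomial a\<close> that of $(1+z)^a$.\<close>

definition binomial_log_family :: "nat \<Rightarrow> (nat \<Rightarrow> 'a::field_char_0) \<Rightarrow> (nat \<Rightarrow> nat) \<Rightarrow> 'a fps list" where
  "binomial_log_family m \<omega> r =
     concat (map (\<lambda>i. map (\<lambda>j. fps_binomial (\<omega> i) * fps_ln 1 ^ j) [0..<r i]) [1..<m + 1])"

definition log_subst :: "'a::field_char_0 fps \<Rightarrow> 'a fps" where
  "log_subst f = fps_compose f (fps_ln 1)"

definition fps_algebra_iso :: "('a::field fps \<Rightarrow> 'a fps) \<Rightarrow> bool" where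
  "fps_algebra_iso T \<longleftrightarrow>
     bij T \<and> T 1 = 1 \<and>
     (\<forall>f g. T (f + g) = T f + T g) \<and>
     (\<forall>f g. T (f * g) = T f * T g) \<and>
     (\<forall>c f. T (fps_const c * f) = fps_const c * T f)"

text \<open>
  The lengths of the weights and of the families agree, so that the length conditions in
  \<^const>\<open>pade_system\<close> hold for them.
\<close>

lemma length_n_index:
  assumes "\<And>i. 1 \<le> i \<Longrightarrow> i \<le> m \<Longrightarrow> (\<Sum>v=1..l i. s i v) = r i"
  shows "length (n_index m l s n) = length (binomial_log_family m \<omega> r)"
proof -
  have "length (n_block l s n i) = r i" if "i \<in> set [1..<m + 1]" for i
  proof -
    have "length (n_block l s n i) = (\<Sum>v\<in>{1..<l i + 1}. s i v)"
      by (simp add: n_block_def length_concat o_def interv_sum_list_conv_sum_set_nat del: upt_Suc)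
    with assms[of i] that show ?thesis
      by (auto simp: atLeastLessThanSuc_atLeastAtMost)
  qed
  then have "map (length \<circ> n_block l s n) [1..<m + 1] = map r [1..<m + 1]"
    by (intro map_cong) auto
  then show ?thesis
    by (simp add: n_index_def binomial_log_family_def length_concat o_def del: upt_Suc map_eq_conv)
qed

lemma length_r_index:
  assumes "\<And>i. 1 \<le> i \<Longrightarrow> i \<le> m \<Longrightarrow> 1 \<le> l i"
    and "\<And>i u v. 1 \<le> i \<Longrightarrow> i \<le> m \<Longrightarrow> 1 \<le> u \<Longrightarrow> u < v \<Longrightarrow> v \<le> l i \<Longrightarrow> n i v < n i u"
  shows "length (r_index m r l s n) = length (exp_family m \<omega> n)"
proof -
  have tele: "(\<Sum>v\<leftarrow>[1..<k]. f v - f (v + 1)) + f k = f 1"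
    if "1 \<le> k" "\<And>u v. 1 \<le> u \<Longrightarrow> u < v \<Longrightarrow> v \<le> k \<Longrightarrow> f v < f u" for f :: "nat \<Rightarrow> nat" and k
    using that
  proof (induction k rule: dec_induct)
    case (step k)
    have "f (Suc k) < f k" using step by auto
    moreover have "(\<Sum>v\<leftarrow>[1..<k]. f v - f (v + 1)) + f k = f 1" using step by auto
    ultimately show ?case using step.hyps by simp
  qed simp
  have "length (r_block r l s n i) = n i 1 + 1" if "i \<in> set [1..<m + 1]" for i
    using tele[of "l i" "n i"] assms[of i] that
    by (auto simp: r_block_def length_concat o_def rev_map[symmetric] simp del: upt_Suc)
  then have "map (length \<circ> r_block r l s n) [1..<m + 1] = map (\<lambda>i. n i 1 + 1) [1..<m + 1]"
    by (intro map_cong) auto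
  then show ?thesis
    by (simp add: r_index_def exp_family_def length_concat o_def del: upt_Suc map_eq_conv)
qed

end

theory Submission
  imports Defs
begin

text \<open>
  Since \<open>\<T>\<close> sends \<open>z\<^sup>j e\<^bsup>(\<omega>+k)z\<^esup>\<close> to
  \<open>(1+z)\<^sup>k (1+z)\<^bsup>\<omega>\<^esup> log\<^sup>j(1+z)\<close>, transposing the coefficient array
  \<open>(k, j)\<close> turns tuples on the exponential side into tuples on the logarithmic side, the
  polynomials in the latter being expanded in powers of \<open>1+z\<close>. The weights \<open>r\<close> and
  \<open>n\<close> describe the rows and the columns of the same staircase diagrams, so the degree
  bounds correspond; both orders of approximation are the number of cells minus one, and
  \<open>\<T>\<close> preserves orders. Normality holds because a nonzero exponential polynomial is
  annihilated by a monic linear differential operator with constant coefficients whose order is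
  the number of cells, so it cannot vanish to that order at the origin.
\<close>

section \<open>Vanishing orders of exponential polynomials\<close>

lemma le_fps_ord_iff: "enat N \<le> fps_ord f \<longleftrightarrow> (\<forall>k<N. fps_nth f k = 0)"
  by (auto simp: fps_ord_def intro: subdegree_geI nth_less_subdegree_zero)

text \<open>
  The bound \<open>c x\<close> counts coefficients instead of bounding the degree, so that
  \<open>c x = 0\<close> says \<open>P x = 0\<close>: applying \<open>D - e y\<close> lowers \<open>c y\<close> by one,
  keeps the other bounds, and costs one order of vanishing.
\<close>

lemma exp_poly_sum_eq_0:
  fixes e :: "'b \<Rightarrow> 'a::field_char_0" and P :: "'b \<Rightarrow> 'a poly"
  assumes "finite A" "inj_on e A"
    and "\<And>x k. x \<in> A \<Longrightarrow> c x \<le> k \<Longrightarrow> coeff (P x) k = 0"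
    and "\<And>k. k < (\<Sum>x\<in>A. c x) \<Longrightarrow> fps_nth (\<Sum>x\<in>A. fps_of_poly (P x) * fps_exp (e x)) k = 0"
    and "x \<in> A"
  shows "P x = 0"
  using assms
proof (induction "\<Sum>x\<in>A. c x" arbitrary: c P x)
  case 0
  then show ?case by (auto simp: poly_eq_iff)
next
  case (Suc N)
  define R where "R = (\<Sum>x\<in>A. fps_of_poly (P x) * fps_exp (e x))"
  obtain y where y: "y \<in> A" "c y > 0"
    using Suc.hyps(2) \<open>finite A\<close> by (metis gr0I nat.distinct(1) sum.neutral)
  \<comment> \<open>\<open>Q x\<close> is the polynomial factor of the image of \<open>P x\<close>
    times exp(\<open>e x\<close> z) under d/dz - \<open>e y\<close>.\<close>
  define Q where "Q x = pderiv (P x) + smult (e x - e y) (P x)" for x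
  define d where "d = c(y := c y - 1)"
  have "(\<Sum>x\<in>A. c x) = (\<Sum>x\<in>A. d x) + 1"
    using y \<open>finite A\<close> by (simp add: d_def sum.remove[of A y])
  then have N: "N = (\<Sum>x\<in>A. d x)"
    using Suc.hyps(2) by simp
  \<comment> \<open>At \<open>y\<close> the scalar term cancels and only the derivative is left,
    which shifts coefficients down by one; elsewhere the old bound survives.\<close>
  have coeff_Q: "coeff (Q x) k = 0" if "x \<in> A" "d x \<le> k" for x k
    using Suc.prems(3)[of x k] Suc.prems(3)[of x "Suc k"] that y
    by (cases "x = y") (auto simp: Q_def d_def coeff_pderiv)
  have "fps_deriv R - fps_const (e y) * R = (\<Sum>x\<in>A. fps_of_poly (Q x) * fps_exp (e x))"
    unfolding R_def Q_def
    by (simp add: fps_deriv_sum sum_distrib_left sum_subtractf[symmetric] fps_of_poly_simps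
      algebra_simps flip: fps_const_sub)
  \<comment> \<open>Coefficient \<open>k\<close> of the derivative comes from coefficient
    \<open>Suc k\<close> of \<open>R\<close>: this is the lost order of vanishing.\<close>
  moreover have "fps_nth (fps_deriv R - fps_const (e y) * R) k = 0" if "k < N" for k
    using Suc.prems(4)[of k] Suc.prems(4)[of "Suc k"] Suc.hyps(2) that by (simp flip: R_def)
  ultimately have "fps_nth (\<Sum>x\<in>A. fps_of_poly (Q x) * fps_exp (e x)) k = 0" if "k < N" for k
    using that by simp
  then have Q0: "Q x = 0" if "x \<in> A" for x
    using Suc.hyps(1)[of d Q x] N \<open>finite A\<close> \<open>inj_on e A\<close> coeff_Q that by blast
  \<comment> \<open>\<open>Q x = 0\<close> makes a nonzero multiple of \<open>P x\<close> equal to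
    minus its derivative, which has no term in the top degree of \<open>P x\<close>.\<close>
  have P0: "P x = 0" if "x \<in> A" "x \<noteq> y" for x
  proof (rule ccontr)
    assume "P x \<noteq> 0"
    have "smult (e x - e y) (P x) = - pderiv (P x)"
      using Q0[OF that(1)] by (simp add: Q_def eq_neg_iff_add_eq_0 add.commute)
    then have "coeff (smult (e x - e y) (P x)) (degree (P x)) = coeff (- pderiv (P x)) (degree (P x))"
      by simp
    then have "(e x - e y) * lead_coeff (P x) = 0"
      by (simp add: coeff_pderiv coeff_eq_0 del: mult_eq_0_iff)
    with \<open>P x \<noteq> 0\<close> that y \<open>inj_on e A\<close> show False by (simp add: inj_on_eq_iff)
  qed
  \<comment> \<open>Only the term of \<open>y\<close> is left. Since \<open>Q y\<close> is the
    derivative of \<open>P y\<close>, that polynomial is constant, and its value is the constant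
    term of \<open>R\<close>.\<close>
  have "R = fps_of_poly (P y) * fps_exp (e y)"
    using \<open>finite A\<close> y P0 by (simp add: R_def sum.remove[of A y])
  then have "coeff (P y) 0 = 0"
    using Suc.prems(4)[of 0] Suc.hyps(2) by (simp flip: R_def)
  moreover have "degree (P y) = 0"
    using Q0[OF y(1)] by (simp add: Q_def pderiv_eq_0_iff)
  ultimately have "P y = 0"
    using leading_coeff_0_iff[of "P y"] by simp
  with P0 Suc.prems(5) show ?case by blast
qed

text \<open>A polynomial of degree at most \<open>w x\<close> has \<open>w x + 1\<close>
  coefficients, so \<open>exp_poly_sum_eq_0\<close> with \<open>c x = w x + 1\<close> excludes any
  higher order.\<close>

lemma fps_ord_exp_poly_sum_less:
  fixes e :: "'b \<Rightarrow> 'a::field_char_0"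
  assumes "finite A" "inj_on e A" "\<forall>x\<in>A. degree (P x) \<le> w x" "\<exists>x\<in>A. P x \<noteq> 0"
  shows "fps_ord (\<Sum>x\<in>A. fps_of_poly (P x) * fps_exp (e x)) < enat (\<Sum>x\<in>A. w x + 1)"
proof (rule ccontr)
  assume "\<not> ?thesis"
  then have ord: "\<forall>k<(\<Sum>x\<in>A. w x + 1). fps_nth (\<Sum>x\<in>A. fps_of_poly (P x) * fps_exp (e x)) k = 0"
    by (simp only: not_less le_fps_ord_iff)
  have coeff: "coeff (P x) k = 0" if "x \<in> A" "w x + 1 \<le> k" for x k
    using assms(3) that by (force intro: coeff_eq_0)
  have "P x = 0" if "x \<in> A" for x
    by (rule exp_poly_sum_eq_0[OF assms(1,2) coeff _ that]) (use ord in auto)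
  with assms(4) show False by blast
qed

section \<open>Substitution of log(1+z)\<close>

text \<open>By the chain rule, the composite f solves (1+z) f' = c f with f(0) = 1, which
  characterises the binomial series.\<close>

lemma log_subst_exp: "log_subst (fps_exp c) = fps_binomial (c::'a::field_char_0)"
  by (subst fps_binomial_ODE_unique'[symmetric])
     (simp add: log_subst_def fps_compose_deriv fps_ln_deriv fps_compose_mult_distrib fps_divide_unit)

lemma log_subst_fps_X: "log_subst fps_X = fps_ln (1::'a::field_char_0)"
  by (simp add: log_subst_def fps_eq_iff fps_X_fps_compose)

text \<open>log(1+z) has order 1, and composition multiplies subdegrees.\<close>

lemma fps_ord_log_subst: "fps_ord (log_subst f) = fps_ord (f::'a::field_char_0 fps)"
proof -
  have nz: "fps_nth (fps_ln (1::'a)) (Suc 0) \<noteq> 0"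
    by (simp add: fps_ln_nth)
  then have "subdegree (fps_ln (1::'a)) = 1"
    by (intro subdegreeI) auto
  moreover have "fps_ln (1::'a) \<noteq> 0"
    using nz by auto
  ultimately show ?thesis
    by (simp add: fps_ord_def log_subst_def fps_compose_eq_0_iff)
qed

text \<open>The inverse map is the substitution of exp(z) - 1.\<close>

lemma fps_algebra_iso_log_subst: "fps_algebra_iso (log_subst :: 'a::field_char_0 fps \<Rightarrow> 'a fps)"
proof -
  let ?E = "fps_exp 1 - 1 :: 'a fps"
  have *: "?E oo fps_ln 1 = fps_X" "fps_ln 1 oo ?E = fps_X"
    using fps_inv_fps_exp_compose[of "1::'a"] by (simp_all add: fps_ln_fps_exp_inv)
  have "bij (log_subst :: 'a fps \<Rightarrow> 'a fps)"
  proof (rule bij_betw_byWitness[where f' = "\<lambda>f. f oo ?E"])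
    show "\<forall>f\<in>UNIV. log_subst f oo ?E = f"
      by (simp add: log_subst_def * flip: fps_compose_assoc)
    show "\<forall>f\<in>UNIV. log_subst (f oo ?E) = f"
      by (simp add: log_subst_def * flip: fps_compose_assoc)
  qed auto
  then show ?thesis
    by (simp add: fps_algebra_iso_def log_subst_def fps_compose_add_distrib fps_compose_mult_distrib)
qed

section \<open>Exchanging polynomial degree and family index\<close>

lemma poly_eq_sum_monom:
  assumes "degree p < N"
  shows "p = (\<Sum>k<N. monom (coeff p k) k)"
  using poly_as_sum_of_monoms'[of p "N - 1"] assms
  by (cases N) (auto simp: lessThan_Suc_atMost)

lemma fps_of_poly_pcompose_1_X:
  assumes "degree p < N"
  shows "fps_of_poly (p \<circ>\<^sub>p [:1, 1:]) =
    (\<Sum>k<N. fps_const (coeff p k) * (1 + fps_X) ^ k :: 'a::field_char_0 fps)"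
proof -
  have power: "(q ^ k) \<circ>\<^sub>p [:1, 1:] = (q \<circ>\<^sub>p [:1, 1:]) ^ k" for q :: "'a poly" and k
    by (induction k) (simp_all add: pcompose_mult pcompose_1)
  have X: "[:0, 1:] \<circ>\<^sub>p [:1, 1:] = ([:1, 1:] :: 'a poly)"
    by (simp add: pcompose_pCons)
  have "p \<circ>\<^sub>p [:1, 1:] = (\<Sum>k<N. smult (coeff p k) ([:1, 1:] ^ k))"
    by (subst poly_eq_sum_monom[OF assms])
       (simp add: pcompose_sum pcompose_smult monom_altdef power X)
  then show ?thesis
    by (simp add: fps_of_poly_simps add.commute)
qed

lemma pcompose_shift_back:
  fixes p :: "'a::comm_ring_1 poly"
  shows "p \<circ>\<^sub>p [:-1, 1:] \<circ>\<^sub>p [:1, 1:] = p" "p \<circ>\<^sub>p [:1, 1:] \<circ>\<^sub>p [:-1, 1:] = p"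
  by (simp_all add: pcompose_pCons flip: pcompose_assoc)

text \<open>Both sides are the double sum of \<open>coeff (P j) k\<close> times
  \<open>(1 + fps_X) ^ k * fps_binomial \<omega> * fps_ln 1 ^ j\<close>, summed in opposite
  orders.\<close>

lemma log_subst_transpose:
  fixes \<omega> :: "'a::field_char_0"
  assumes P: "\<And>j. j < r \<Longrightarrow> degree (P j) < N"
    and Q: "\<And>k. k < N \<Longrightarrow> degree (Q k) < r"
    and PQ: "\<And>j k. j < r \<Longrightarrow> k < N \<Longrightarrow> coeff (Q k) j = coeff (P j) k"
  shows "log_subst (\<Sum>k<N. fps_of_poly (Q k) * fps_exp (\<omega> + of_nat k)) =
    (\<Sum>j<r. fps_of_poly (P j \<circ>\<^sub>p [:1, 1:]) * (fps_binomial \<omega> * fps_ln 1 ^ j))"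
proof -
  have Q': "fps_of_poly (Q k) = (\<Sum>j<r. fps_const (coeff (P j) k) * fps_X ^ j)" if "k < N" for k
    using PQ that by (subst poly_eq_sum_monom[OF Q[OF that]]) (simp add: fps_of_poly_sum fps_of_poly_monom)
  have "log_subst (\<Sum>k<N. fps_of_poly (Q k) * fps_exp (\<omega> + of_nat k)) =
      (\<Sum>k<N. \<Sum>j<r. fps_const (coeff (P j) k) * fps_ln 1 ^ j *
        (fps_binomial \<omega> * (1 + fps_X) ^ k))"
    by (simp add: log_subst_def Q' log_subst_exp[unfolded log_subst_def]
      log_subst_fps_X[unfolded log_subst_def] fps_compose_sum_distrib fps_compose_mult_distrib
      sum_distrib_right fps_binomial_add_mult fps_binomial_of_nat flip: fps_compose_power)
  also have "\<dots> = (\<Sum>j<r. fps_of_poly (P j \<circ>\<^sub>p [:1, 1:]) * (fps_binomial \<omega> * fps_ln 1 ^ j))"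
    by (subst sum.swap)
       (simp add: fps_of_poly_pcompose_1_X[OF P] sum_distrib_left sum_distrib_right mult_ac)
  finally show ?thesis .
qed

section \<open>Pade approximations over an index set\<close>

lemma sum_nth_distinct:
  "distinct L \<Longrightarrow> (\<Sum>j<length L. f (L ! j)) = sum f (set L)"
  by (metis bij_betw_nth sum.reindex_bij_betw)

lemma ex_map_of_length_eq:
  assumes "distinct L" "length P = length L"
  obtains Q where "P = map Q L"
proof
  show "P = map (\<lambda>x. the (map_of (zip L P) x)) L"
    using assms by (intro nth_equalityI) (auto simp: map_of_zip_nth)
qed

lemma pade_sum_map:
  "distinct L \<Longrightarrow> pade_sum (map F L) (map Q L) = (\<Sum>x\<in>set L. fps_of_poly (Q x) * F x)"
  by (simp add: pade_sum_def flip: sum_nth_distinct)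

text \<open>Replaces list positions by the elements of \<open>L\<close>: as \<open>L\<close> is
  distinct, every tuple of the right length is \<open>map Q L\<close> for some function
  \<open>Q\<close>.\<close>

lemma pade_approximations_map:
  assumes "distinct L"
  shows "pade_approximations (map F L) (map G L) =
    {\<Sum>x\<in>set L. fps_of_poly (Q x) * F x | Q.
      (\<exists>x\<in>set L. Q x \<noteq> 0) \<and> (\<forall>x\<in>set L. degree (Q x) \<le> G x) \<and>
      enat ((\<Sum>x\<in>set L. G x + 1) - 1) \<le> fps_ord (\<Sum>x\<in>set L. fps_of_poly (Q x) * F x)}"
proof -
  have order: "pade_order (map G L) = (\<Sum>x\<in>set L. G x + 1) - 1"
    using sum_nth_distinct[OF assms, of "\<lambda>x. G x + 1"] by (simp add: pade_order_def)
  have system: "pade_system (map F L) (map G L) (map Q L) \<longleftrightarrow>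
      (\<exists>x\<in>set L. Q x \<noteq> 0) \<and> (\<forall>x\<in>set L. degree (Q x) \<le> G x) \<and>
      enat ((\<Sum>x\<in>set L. G x + 1) - 1) \<le> fps_ord (\<Sum>x\<in>set L. fps_of_poly (Q x) * F x)" for Q
    by (auto simp: pade_system_def order pade_sum_map[OF assms] Ball_def Bex_def in_set_conv_nth)
  have "pade_approximations (map F L) (map G L) =
    {pade_sum (map F L) (map Q L) | Q. pade_system (map F L) (map G L) (map Q L)}"
    unfolding pade_approximations_def
  proof (intro Collect_cong iffI; clarify)
    fix P assume P: "pade_system (map F L) (map G L) P"
    then obtain Q where "P = map Q L"
      using ex_map_of_length_eq[OF assms, of P] by (auto simp: pade_system_def)
    with P show "\<exists>Q. pade_sum (map F L) P = pade_sum (map F L) (map Q L) \<and>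
        pade_system (map F L) (map G L) (map Q L)"
      by blast
  qed blast
  then show ?thesis
    by (simp only: system pade_sum_map[OF assms])
qed

text \<open>The lexicographic index list; both families and both weights are maps over such a
  list.\<close>

definition pair_list :: "nat \<Rightarrow> (nat \<Rightarrow> nat) \<Rightarrow> (nat \<times> nat) list" where
  "pair_list m f = concat (map (\<lambda>i. map (Pair i) [0..<f i]) [1..<m + 1])"

lemma set_pair_list: "set (pair_list m f) = (SIGMA i:{1..m}. {..<f i})"
  by (auto simp: pair_list_def)

lemma distinct_pair_list: "distinct (pair_list m f)"
proof -
  have "distinct (concat (map (\<lambda>i. map (Pair i) [0..<f i]) xs))" if "distinct xs" for xs
    using that by (induction xs) (auto simp: distinct_map inj_on_def)
  then show ?thesis by (simp add: pair_list_def del: upt_Suc)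
qed

lemma map_pair_list:
  "map F (pair_list m f) = concat (map (\<lambda>i. map (\<lambda>k. F (i, k)) [0..<f i]) [1..<m + 1])"
  by (simp add: pair_list_def map_concat o_def del: upt_Suc)

lemma concat_map_eq_pair_list:
  assumes "\<And>i. i \<in> {1..m} \<Longrightarrow> length (g i) = f i"
  shows "concat (map g [1..<m + 1]) = map (\<lambda>(i, k). g i ! k) (pair_list m f)"
  unfolding map_pair_list
proof (intro arg_cong[where f = concat] map_cong refl)
  fix i assume "i \<in> set [1..<m + 1]"
  then have "length (g i) = f i"
    by (intro assms) auto
  then show "g i = map (\<lambda>k. case (i, k) of (i, k) \<Rightarrow> g i ! k) [0..<f i]"
    using map_nth[of "g i"] by simp
qed

section \<open>Staircase shape of the weights\<close>

text \<open>
  Adjoining the block \<open>L + 1\<close> to \<open>nb\<close> overwrites the first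
  \<open>n (L + 1) + 1\<close> entries of \<open>rb\<close>.
\<close>

lemma block_conjugate:
  fixes s n :: "nat \<Rightarrow> nat"
  defines "S L \<equiv> \<Sum>u=1..L. s u"
  defines "nb L \<equiv> concat (map (\<lambda>v. replicate (s v) (n v)) [1..<L + 1])"
  defines "rb L \<equiv> replicate (n L + 1) (S L - 1) @
    concat (map (\<lambda>v. replicate (n v - n (v + 1)) (S v - 1)) (rev [1..<L]))"
  assumes "1 \<le> L" "\<And>v. 1 \<le> v \<Longrightarrow> v \<le> L \<Longrightarrow> 1 \<le> s v"
    and "\<And>u v. 1 \<le> u \<Longrightarrow> u < v \<Longrightarrow> v \<le> L \<Longrightarrow> n v < n u"
  shows "length (nb L) = S L \<and> length (rb L) = n 1 + 1 \<and>
    (\<forall>j<S L. n L \<le> nb L ! j \<and> nb L ! j \<le> n 1) \<and> (\<forall>k\<le>n 1. rb L ! k < S L) \<and>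
    (\<forall>j<S L. \<forall>k\<le>n 1. k \<le> nb L ! j \<longleftrightarrow> j \<le> rb L ! k)"
  using assms(4-)
proof (induction L rule: dec_induct)
  case base
  have "S 1 \<ge> 1" using base(1)[of 1] by (simp add: S_def)
  moreover have "nb 1 = replicate (s 1) (n 1)" "rb 1 = replicate (n 1 + 1) (S 1 - 1)" "S 1 = s 1"
    by (simp_all add: nb_def rb_def S_def)
  ultimately show ?case by (auto simp del: replicate_Suc)
next
  case (step L)
  let ?a = "n (Suc L)"
  have a: "?a < n L" "?a < n 1" and s: "s (Suc L) \<ge> 1"
    using step by auto
  have IH: "length (nb L) = S L" "length (rb L) = n 1 + 1"
    "\<And>j. j < S L \<Longrightarrow> n L \<le> nb L ! j" "\<And>j. j < S L \<Longrightarrow> nb L ! j \<le> n 1"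
    "\<And>k. k \<le> n 1 \<Longrightarrow> rb L ! k < S L"
    "\<And>j k. j < S L \<Longrightarrow> k \<le> n 1 \<Longrightarrow> k \<le> nb L ! j \<longleftrightarrow> j \<le> rb L ! k"
    using step by auto
  have S: "S (Suc L) = S L + s (Suc L)"
    by (simp add: S_def)
  have nb: "nb (Suc L) = nb L @ replicate (s (Suc L)) ?a"
    by (simp add: nb_def)
  \<comment> \<open>As \<open>?a < n L\<close>, the leftmost block of \<open>rb L\<close> can be cut
    after \<open>?a + 1\<close> entries; its remainder is exactly the block \<open>v = L\<close> of
    \<open>rb (Suc L)\<close>.\<close>
  have "rb L = replicate (?a + 1) (S L - 1) @ replicate (n L - ?a) (S L - 1) @
      concat (map (\<lambda>v. replicate (n v - n (v + 1)) (S v - 1)) (rev [1..<L]))"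
    using a by (simp add: rb_def flip: replicate_add append_assoc)
  then have rb: "rb (Suc L) = replicate (?a + 1) (S (Suc L) - 1) @ drop (?a + 1) (rb L)"
    using step.hyps by (simp add: rb_def)
  have rb_nth: "rb (Suc L) ! k = (if k \<le> ?a then S (Suc L) - 1 else rb L ! k)" if "k \<le> n 1" for k
    using that IH(2) a unfolding rb by (auto simp: nth_append nth_drop simp del: replicate_Suc)
  have nb_nth: "nb (Suc L) ! j = (if j < S L then nb L ! j else ?a)" if "j < S (Suc L)" for j
    using that IH(1) unfolding nb S by (auto simp: nth_append)
  have "length (nb (Suc L)) = S (Suc L)" "length (rb (Suc L)) = n 1 + 1"
    using IH(1,2) a by (simp_all add: nb rb S)
  moreover have "?a \<le> nb (Suc L) ! j \<and> nb (Suc L) ! j \<le> n 1" if "j < S (Suc L)" for j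
    using IH(3,4)[of j] a that by (auto simp: nb_nth)
  moreover have "rb (Suc L) ! k < S (Suc L)" if "k \<le> n 1" for k
    using IH(5)[of k] that s by (auto simp: rb_nth S)
  \<comment> \<open>The auxiliary bounds settle the mixed cases. For old \<open>j\<close> and
    \<open>k \<le> ?a\<close> both sides hold, because \<open>?a < n L \<le> nb L ! j\<close>; for
    new \<open>j\<close> and \<open>k > ?a\<close> both fail, because
    \<open>rb L ! k < S L \<le> j\<close>.\<close>
  moreover have "k \<le> nb (Suc L) ! j \<longleftrightarrow> j \<le> rb (Suc L) ! k" if "j < S (Suc L)" "k \<le> n 1" for j k
    using that IH(3)[of j] IH(5)[of k] IH(6)[of j k] a by (auto simp: nb_nth rb_nth S)
  ultimately show ?case by blast
qed


section \<open>Transposition between conjugate weights\<close>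

text \<open>The transpose of the coefficient array of each block; \<open>f i\<close> is the number
  of entries that the original tuple has in block \<open>i\<close>.\<close>

definition swap_coeffs :: "(nat \<Rightarrow> nat) \<Rightarrow> (nat \<times> nat \<Rightarrow> 'a::comm_ring_1 poly) \<Rightarrow> nat \<times> nat \<Rightarrow> 'a poly" where
  "swap_coeffs f P = (\<lambda>(i, k). \<Sum>j<f i. monom (coeff (P (i, j)) k) j)"

lemma coeff_swap_coeffs:
  "coeff (swap_coeffs f P (i, k)) j = (if j < f i then coeff (P (i, j)) k else 0)"
  by (auto simp: swap_coeffs_def coeff_sum sum.delta)

text \<open>For each \<open>i\<close>, the cells \<open>(j, k)\<close> with
  \<open>k \<le> a (i, j)\<close> form a diagram; \<open>a\<close> and \<open>b\<close> are its row
  and column lengths minus one, as suits degree bounds. The symmetry in \<open>dual\<close> makes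
  each lemma below serve both directions.\<close>

locale conjugate_weights =
  fixes M :: "nat set" and p q :: "nat \<Rightarrow> nat" and a b :: "nat \<times> nat \<Rightarrow> nat"
  assumes finite_M: "finite M"
    and a_less: "i \<in> M \<Longrightarrow> j < p i \<Longrightarrow> a (i, j) < q i"
    and b_less: "i \<in> M \<Longrightarrow> k < q i \<Longrightarrow> b (i, k) < p i"
    and conj_iff: "i \<in> M \<Longrightarrow> j < p i \<Longrightarrow> k < q i \<Longrightarrow> k \<le> a (i, j) \<longleftrightarrow> j \<le> b (i, k)"
begin

lemma dual: "conjugate_weights M q p b a"
  by unfold_locales (use finite_M a_less b_less conj_iff in auto)

text \<open>Both sides count the cells, once by rows and once by columns.\<close>

lemma sum_weights_eq:
  "(\<Sum>x\<in>(SIGMA i:M. {..<p i}). a x + 1) = (\<Sum>x\<in>(SIGMA i:M. {..<q i}). b x + 1)"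
proof -
  have "(\<Sum>j<p i. a (i, j) + 1) = (\<Sum>k<q i. b (i, k) + 1)" if i: "i \<in> M" for i
  proof -
    have "a (i, j) + 1 = (\<Sum>k<q i. of_bool (k \<le> a (i, j)))" if "j < p i" for j
    proof -
      have "{..<q i} \<inter> {k. k \<le> a (i, j)} = {..a (i, j)}"
        using a_less[OF i that] by auto
      then show ?thesis by (simp add: sum_of_bool_eq)
    qed
    moreover have "b (i, k) + 1 = (\<Sum>j<p i. of_bool (j \<le> b (i, k)))" if "k < q i" for k
    proof -
      have "{..<p i} \<inter> {j. j \<le> b (i, k)} = {..b (i, k)}"
        using b_less[OF i that] by auto
      then show ?thesis by (simp add: sum_of_bool_eq)
    qed
    moreover have "(\<Sum>j<p i. \<Sum>k<q i. of_bool (k \<le> a (i, j))) =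
        (\<Sum>k<q i. \<Sum>j<p i. of_bool (j \<le> b (i, k)) :: nat)"
      by (subst sum.swap) (simp add: conj_iff[OF i])
    ultimately show ?thesis by simp
  qed
  then show ?thesis
    using finite_M
      sum.Sigma[of M "\<lambda>i. {..<p i}" "\<lambda>i j. a (i, j) + 1"]
      sum.Sigma[of M "\<lambda>i. {..<q i}" "\<lambda>i k. b (i, k) + 1"]
    by (simp add: case_prod_unfold)
qed

definition bounded_tuple :: "(nat \<times> nat \<Rightarrow> 'a::comm_ring_1 poly) \<Rightarrow> bool" where
  "bounded_tuple P \<longleftrightarrow> (\<forall>x\<in>(SIGMA i:M. {..<p i}). degree (P x) \<le> a x)"

text \<open>A coefficient beyond \<open>b (i, k)\<close> sits in a cell outside the diagram, where
  the coefficient of \<open>P\<close> vanishes by the bound \<open>a\<close>.\<close>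

lemma swap_coeffs_bounded:
  assumes "bounded_tuple P" "i \<in> M" "k < q i"
  shows "degree (swap_coeffs p P (i, k)) \<le> b (i, k)"
proof (rule degree_le, intro allI impI)
  fix j assume j: "b (i, k) < j"
  have "degree (P (i, j)) < k" if "j < p i"
    using assms j that conj_iff[of i j k] by (force simp: bounded_tuple_def)
  then show "coeff (swap_coeffs p P (i, k)) j = 0"
    by (simp add: coeff_swap_coeffs coeff_eq_0)
qed

text \<open>The bound \<open>a (i, j) < q i\<close> ensures that the cutoff at \<open>q i\<close>
  loses no coefficient.\<close>

lemma swap_coeffs_swap_coeffs:
  assumes "bounded_tuple P" "i \<in> M" "j < p i"
  shows "swap_coeffs q (swap_coeffs p P) (i, j) = P (i, j)"
proof -
  have "degree (P (i, j)) < q i"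
    using assms a_less[of i j] by (force simp: bounded_tuple_def)
  then show ?thesis
    using assms by (auto simp: poly_eq_iff coeff_swap_coeffs coeff_eq_0)
qed

lemma swap_coeffs_nonzero:
  assumes "bounded_tuple P" "\<exists>x\<in>(SIGMA i:M. {..<p i}). P x \<noteq> 0"
  shows "\<exists>x\<in>(SIGMA i:M. {..<q i}). swap_coeffs p P x \<noteq> 0"
proof (rule ccontr)
  assume *: "\<not> ?thesis"
  obtain i j where ij: "i \<in> M" "j < p i" "P (i, j) \<noteq> 0"
    using assms(2) by auto
  have "swap_coeffs q (swap_coeffs p P) (i, j) = 0"
    using * ij by (simp add: swap_coeffs_def[of q])
  with swap_coeffs_swap_coeffs[OF assms(1) ij(1,2)] ij(3) show False by simp
qed

text \<open>Applies \<open>log_subst_transpose\<close> block by block. \<open>Q\<close> has to agree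
  with the transpose only on the index set, so \<open>P\<close> may itself be a transpose of
  \<open>Q\<close>.\<close>

lemma log_subst_exp_sum:
  fixes \<omega> :: "nat \<Rightarrow> 'a::field_char_0"
  assumes P: "bounded_tuple P"
    and Q: "\<And>i k. i \<in> M \<Longrightarrow> k < q i \<Longrightarrow> Q (i, k) = swap_coeffs p P (i, k)"
  shows "log_subst (\<Sum>(i, k)\<in>(SIGMA i:M. {..<q i}). fps_of_poly (Q (i, k)) * fps_exp (\<omega> i + of_nat k)) =
    (\<Sum>(i, j)\<in>(SIGMA i:M. {..<p i}).
      fps_of_poly (P (i, j) \<circ>\<^sub>p [:1, 1:]) * (fps_binomial (\<omega> i) * fps_ln 1 ^ j))"
proof -
  have "log_subst (\<Sum>k<q i. fps_of_poly (Q (i, k)) * fps_exp (\<omega> i + of_nat k)) =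
      (\<Sum>j<p i. fps_of_poly (P (i, j) \<circ>\<^sub>p [:1, 1:]) * (fps_binomial (\<omega> i) * fps_ln 1 ^ j))"
    if i: "i \<in> M" for i
  proof (rule log_subst_transpose)
    show "degree (P (i, j)) < q i" if "j < p i" for j
      using P i that a_less[of i j] by (force simp: bounded_tuple_def)
    show "degree (Q (i, k)) < p i" if "k < q i" for k
      using swap_coeffs_bounded[OF P i that] b_less[OF i that] Q[OF i that] by simp
    show "coeff (Q (i, k)) j = coeff (P (i, j)) k" if "j < p i" "k < q i" for j k
      using that by (simp add: Q[OF i] coeff_swap_coeffs)
  qed
  then show ?thesis
    using finite_M by (simp add: log_subst_def fps_compose_sum_distrib flip: sum.Sigma)
qed

end

lemma conjugate_weights_blocks:
  assumes "\<And>i. 1 \<le> i \<Longrightarrow> i \<le> m \<Longrightarrow> 1 \<le> l i"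
    and "\<And>i v. 1 \<le> i \<Longrightarrow> i \<le> m \<Longrightarrow> 1 \<le> v \<Longrightarrow> v \<le> l i \<Longrightarrow> 1 \<le> s i v"
    and "\<And>i. 1 \<le> i \<Longrightarrow> i \<le> m \<Longrightarrow> (\<Sum>v=1..l i. s i v) = r i"
    and "\<And>i u v. 1 \<le> i \<Longrightarrow> i \<le> m \<Longrightarrow> 1 \<le> u \<Longrightarrow> u < v \<Longrightarrow> v \<le> l i \<Longrightarrow> n i v < n i u"
  shows "conjugate_weights {1..m} r (\<lambda>i. n i 1 + 1)
      (\<lambda>(i, j). n_block l s n i ! j) (\<lambda>(i, k). r_block r l s n i ! k)"
    and "\<And>i. i \<in> {1..m} \<Longrightarrow> length (n_block l s n i) = r i"
    and "\<And>i. i \<in> {1..m} \<Longrightarrow> length (r_block r l s n i) = n i 1 + 1"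
proof -
  have *: "length (n_block l s n i) = r i \<and> length (r_block r l s n i) = n i 1 + 1 \<and>
      (\<forall>j<r i. n i (l i) \<le> n_block l s n i ! j \<and> n_block l s n i ! j \<le> n i 1) \<and>
      (\<forall>k\<le>n i 1. r_block r l s n i ! k < r i) \<and>
      (\<forall>j<r i. \<forall>k\<le>n i 1. k \<le> n_block l s n i ! j \<longleftrightarrow> j \<le> r_block r l s n i ! k)"
    if "i \<in> {1..m}" for i
  proof -
    from that have i: "1 \<le> i" "i \<le> m" by auto
    show ?thesis
      using block_conjugate[OF assms(1)[OF i], of "s i" "n i", OF assms(2)[OF i] assms(4)[OF i]]
      unfolding n_block_def r_block_def assms(3)[OF i] by blast
  qed
  then show "conjugate_weights {1..m} r (\<lambda>i. n i 1 + 1)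
      (\<lambda>(i, j). n_block l s n i ! j) (\<lambda>(i, k). r_block r l s n i ! k)"
    by unfold_locales (auto simp: less_Suc_eq_le)
  show "\<And>i. i \<in> {1..m} \<Longrightarrow> length (n_block l s n i) = r i"
    and "\<And>i. i \<in> {1..m} \<Longrightarrow> length (r_block r l s n i) = n i 1 + 1"
    using * by blast+
qed

section \<open>The bijection and normality\<close>

theorem proposition3p8:
  fixes \<omega> :: "nat \<Rightarrow> 'a::field_char_0"
    and m :: nat
    and r l :: "nat \<Rightarrow> nat"
    and s n :: "nat \<Rightarrow> nat \<Rightarrow> nat"
  assumes "m \<ge> 1"
    and "\<And>i. 1 \<le> i \<Longrightarrow> i \<le> m \<Longrightarrow> 1 \<le> r i"
    and "\<And>i j. 1 \<le> i \<Longrightarrow> i < j \<Longrightarrow> j \<le> m \<Longrightarrow> \<omega> i - \<omega> j \<notin> \<int>"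
    and "\<And>i. 1 \<le> i \<Longrightarrow> i \<le> m \<Longrightarrow> 1 \<le> l i \<and> l i \<le> r i"
    and "\<And>i v. 1 \<le> i \<Longrightarrow> i \<le> m \<Longrightarrow> 1 \<le> v \<Longrightarrow> v \<le> l i \<Longrightarrow> 1 \<le> s i v"
    and "\<And>i. 1 \<le> i \<Longrightarrow> i \<le> m \<Longrightarrow> (\<Sum>v=1..l i. s i v) = r i"
    and "\<And>i u v. 1 \<le> i \<Longrightarrow> i \<le> m \<Longrightarrow> 1 \<le> u \<Longrightarrow> u < v \<Longrightarrow> v \<le> l i \<Longrightarrow> n i v < n i u"
  shows "fps_algebra_iso (log_subst :: 'a fps \<Rightarrow> 'a fps)
       \<and> bij_betw log_subst
           (pade_approximations (exp_family m \<omega> n) (r_index m r l s n))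
           (pade_approximations (binomial_log_family m \<omega> r) (n_index m l s n))
       \<and> normal_index (binomial_log_family m \<omega> r) (n_index m l s n)"
proof -
  define M where "M = {1..m}"
  define N where "N i = n i 1 + 1" for i
  define h where "h = (\<lambda>(i, j). n_block l s n i ! j)"
  define g where "g = (\<lambda>(i, k). r_block r l s n i ! k)"
  note blocks = conjugate_weights_blocks[of m l s r n, folded M_def N_def h_def g_def]
  interpret C: conjugate_weights M r N h g
    by (rule blocks(1)) (use assms(4-7) in auto)
  interpret D: conjugate_weights M N r g h
    by (rule C.dual)
  define I J where "I = (SIGMA i:M. {..<N i})" and "J = (SIGMA i:M. {..<r i})"
  define F G where "F = (\<lambda>(i, k). fps_exp (\<omega> i + of_nat k))"
    and "G = (\<lambda>(i, j). fps_binomial (\<omega> i) * fps_ln 1 ^ j)"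
  \<comment> \<open>The common number of cells, so that both orders of approximation are
    \<open>d - 1\<close>.\<close>
  define d where "d = (\<Sum>x\<in>I. g x + 1)"
  define expsum where "expsum Q = (\<Sum>x\<in>I. fps_of_poly (Q x) * F x)" for Q
  define logsum where "logsum P = (\<Sum>x\<in>J. fps_of_poly (P x) * G x)" for P
  have d: "(\<Sum>x\<in>J. h x + 1) = d"
    using C.sum_weights_eq by (simp add: d_def I_def J_def)
  have lists: "exp_family m \<omega> n = map F (pair_list m N)" "r_index m r l s n = map g (pair_list m N)"
    "binomial_log_family m \<omega> r = map G (pair_list m r)" "n_index m l s n = map h (pair_list m r)"
    using concat_map_eq_pair_list[of m "r_block r l s n" N]
      concat_map_eq_pair_list[of m "n_block l s n" r] blocks(2,3) assms(4-7)
    by (simp_all add: M_def exp_family_def binomial_log_family_def map_pair_list F_def G_def N_def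
      r_index_def n_index_def g_def h_def del: upt_Suc)
  have V: "pade_approximations (exp_family m \<omega> n) (r_index m r l s n) =
      {expsum Q | Q. (\<exists>x\<in>I. Q x \<noteq> 0) \<and> D.bounded_tuple Q \<and> enat (d - 1) \<le> fps_ord (expsum Q)}"
    unfolding lists pade_approximations_map[OF distinct_pair_list] set_pair_list M_def[symmetric]
    by (simp only: D.bounded_tuple_def expsum_def d_def I_def)
  have W: "pade_approximations (binomial_log_family m \<omega> r) (n_index m l s n) =
      {logsum P | P. (\<exists>x\<in>J. P x \<noteq> 0) \<and> C.bounded_tuple P \<and> enat (d - 1) \<le> fps_ord (logsum P)}"
    unfolding lists pade_approximations_map[OF distinct_pair_list] set_pair_list M_def[symmetric]
    by (simp only: C.bounded_tuple_def logsum_def d[symmetric] J_def)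
  have transfer: "log_subst (expsum Q) = logsum (\<lambda>x. P x \<circ>\<^sub>p [:1, 1:])"
    if "C.bounded_tuple P" "\<And>i k. i \<in> M \<Longrightarrow> k < N i \<Longrightarrow> Q (i, k) = swap_coeffs r P (i, k)" for P Q
    using C.log_subst_exp_sum[of P Q \<omega>] that
    by (simp add: expsum_def logsum_def F_def G_def I_def J_def case_prod_unfold)
  \<comment> \<open>Translating the variable preserves degrees and nonvanishing.\<close>
  have shift: "C.bounded_tuple (\<lambda>x. P x \<circ>\<^sub>p q) \<longleftrightarrow> C.bounded_tuple P"
    "(\<exists>x\<in>J. P x \<circ>\<^sub>p q \<noteq> 0) \<longleftrightarrow> (\<exists>x\<in>J. P x \<noteq> 0)"
    if "q = [:1, 1:] \<or> q = [:-1, 1:]" for q :: "'a poly" and P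
    using that by (auto simp: C.bounded_tuple_def degree_pcompose pcompose_eq_0_iff)
  have image: "log_subst ` pade_approximations (exp_family m \<omega> n) (r_index m r l s n) =
      pade_approximations (binomial_log_family m \<omega> r) (n_index m l s n)" (is "?T ` ?V = ?W")
  proof (intro equalityI subsetI)
    fix R assume "R \<in> ?T ` ?V"
    then obtain Q where R: "R = log_subst (expsum Q)" and Q: "\<exists>x\<in>I. Q x \<noteq> 0" "D.bounded_tuple Q"
      "enat (d - 1) \<le> fps_ord (expsum Q)"
      unfolding V by blast
    let ?P = "swap_coeffs N Q"
    have P: "C.bounded_tuple ?P"
      using D.swap_coeffs_bounded[OF Q(2)] by (auto simp: C.bounded_tuple_def)
    have "R = logsum (\<lambda>x. ?P x \<circ>\<^sub>p [:1, 1:])"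
      unfolding R using P D.swap_coeffs_swap_coeffs[OF Q(2)] by (intro transfer) auto
    moreover have "\<exists>x\<in>J. ?P x \<noteq> 0"
      using D.swap_coeffs_nonzero[OF Q(2)] Q(1) by (simp add: I_def J_def)
    moreover have "enat (d - 1) \<le> fps_ord R"
      using Q(3) by (simp add: R fps_ord_log_subst)
    moreover have "C.bounded_tuple (\<lambda>x. ?P x \<circ>\<^sub>p [:1, 1:])"
      "(\<exists>x\<in>J. ?P x \<circ>\<^sub>p [:1, 1:] \<noteq> 0) \<longleftrightarrow> (\<exists>x\<in>J. ?P x \<noteq> 0)"
      using P shift[of "[:1, 1:]" ?P] by simp_all
    ultimately show "R \<in> ?W"
      unfolding W by blast
  next
    fix R assume "R \<in> ?W"
    then obtain P where R: "R = logsum P" and P: "\<exists>x\<in>J. P x \<noteq> 0" "C.bounded_tuple P"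
      "enat (d - 1) \<le> fps_ord (logsum P)"
      unfolding W by blast
    \<comment> \<open>The coefficients of \<open>?P x\<close> are those of \<open>P x\<close>
      expanded in powers of 1+z.\<close>
    let ?P = "\<lambda>x. P x \<circ>\<^sub>p [:-1, 1:]"
    let ?Q = "swap_coeffs r ?P"
    have P': "C.bounded_tuple ?P" "\<exists>x\<in>J. ?P x \<noteq> 0"
      using P shift[of "[:-1, 1:]" P] by simp_all
    have eq: "log_subst (expsum ?Q) = R"
      using transfer[OF P'(1), of ?Q] by (simp add: R pcompose_shift_back)
    moreover have "\<exists>x\<in>I. ?Q x \<noteq> 0"
      using C.swap_coeffs_nonzero[OF P'(1)] P'(2) by (simp add: I_def J_def)
    moreover have "D.bounded_tuple ?Q"
      using C.swap_coeffs_bounded[OF P'(1)] by (auto simp: D.bounded_tuple_def)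
    moreover have "enat (d - 1) \<le> fps_ord (expsum ?Q)"
      using P(3) fps_ord_log_subst[of "expsum ?Q"] by (simp add: eq R)
    ultimately show "R \<in> ?T ` ?V"
      unfolding V by blast
  qed
  have iso: "fps_algebra_iso (log_subst :: 'a fps \<Rightarrow> 'a fps)"
    by (rule fps_algebra_iso_log_subst)
  then have "inj (log_subst :: 'a fps \<Rightarrow> 'a fps)"
    by (simp add: fps_algebra_iso_def bij_def)
  then have bij: "bij_betw log_subst ?V ?W"
    using image inj_on_subset[OF _ subset_UNIV] by (auto simp: bij_betw_def)
  have inj: "inj_on (\<lambda>(i, k). \<omega> i + of_nat k) I"
  proof (intro inj_onI; clarify)
    fix i k i' k' assume I: "(i, k) \<in> I" "(i', k') \<in> I" and eq: "\<omega> i + of_nat k = \<omega> i' + of_nat k'"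
    \<comment> \<open>Both signs are needed because the hypothesis on \<open>\<omega>\<close> is
      stated for ordered indices \<open>i < j\<close> only.\<close>
    then have "\<omega> i - \<omega> i' = of_int (int k' - int k)" "\<omega> i' - \<omega> i = of_int (int k - int k')"
      by (simp_all add: algebra_simps)
    then have "\<omega> i - \<omega> i' \<in> \<int>" "\<omega> i' - \<omega> i \<in> \<int>"
      using Ints_of_int by metis+
    with assms(3) I have "i = i'"
      by (metis I_def M_def SigmaD1 atLeastAtMost_iff nat_neq_iff)
    with eq show "i = i' \<and> k = k'" by simp
  qed
  have "fps_ord (log_subst R) = enat (d - 1)" if "R \<in> ?V" for R
  proof -
    from that obtain Q where Q: "R = expsum Q" "\<exists>x\<in>I. Q x \<noteq> 0" "D.bounded_tuple Q"
      "enat (d - 1) \<le> fps_ord R"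
      unfolding V by blast
    \<comment> \<open>With the lower bound \<open>d - 1\<close> from the Pade condition, this leaves
      one possible order.\<close>
    have "fps_ord R < enat d"
      using fps_ord_exp_poly_sum_less[OF _ inj _ Q(2), of g] Q(3)
      by (simp add: Q(1) expsum_def d_def F_def D.bounded_tuple_def I_def case_prod_unfold
        finite_SigmaI C.finite_M)
    with Q(4) show ?thesis
      by (cases "fps_ord R") (auto simp: fps_ord_log_subst)
  qed
  moreover have "pade_order (n_index m l s n) = d - 1"
    using sum_nth_distinct[OF distinct_pair_list, of "\<lambda>x. h x + 1" m r]
    by (simp add: lists pade_order_def d[symmetric] set_pair_list J_def M_def)
  ultimately have "normal_index (binomial_log_family m \<omega> r) (n_index m l s n)"
    unfolding normal_index_def image[symmetric] by auto
  with iso bij show ?thesis by blast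
qed

end
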